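(* For an array $A$ of length $n$, any data structure that encodes the solutions to range maximum-sum segment queries on $A$ must occupy at least $1.89113n - \Theta(\lg n)$ bits, if $n$ is sufficiently large.
   Context: For an array $A[1..n]$ of numbers let $S(i,j)=\sum_{k=i}^{j}A[k]$. A range maximum-sum segment query $\textsc{RMaxSSQ}(A,i,j)$, for $1\le i\le j\le n$, returns the endpoints of a subrange $[i',j']\subseteq[i,j]$ maximizing $S(i',j')$ (ties broken by returning the shortest, rightmost such range; the empty range if $A[i..j]$ has only non-positive entries). A data structure "encodes the solutions" to these queries if it can answer every query $\textsc{RMaxSSQ}(A,i,j)$ without access to $A$; the bound is on the number of bits such a structure needs in the worst case over arrays of length $n$. *)

theory Defs
  imports Complex_Main "HOL-Library.Landau_Symbols"
begin

text \<open>Arrays are lists of reals. All positions in arrays, queries and answers are 1-based,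
  so the entry at position \<open>k\<close> of \<open>A\<close> is \<open>A ! (k - 1)\<close>.\<close>

definition seg_sum :: "real list \<Rightarrow> nat \<Rightarrow> nat \<Rightarrow> real" where
  "seg_sum A i j = (\<Sum>k = i..j. A ! (k - 1))"

definition subranges :: "nat \<Rightarrow> nat \<Rightarrow> (nat \<times> nat) set" where
  "subranges i j = {(i', j'). i \<le> i' \<and> i' \<le> j' \<and> j' \<le> j}"

definition max_sum_segments :: "real list \<Rightarrow> nat \<Rightarrow> nat \<Rightarrow> (nat \<times> nat) set" where
  "max_sum_segments A i j =
     {(i', j') \<in> subranges i j. \<forall>(k, l) \<in> subranges i j. seg_sum A k l \<le> seg_sum A i' j'}"

text \<open>The tie-breaking rule: a shortest maximum-sum segment, and the rightmost one among
  those of this shortest length.\<close>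

definition is_RMaxSS :: "real list \<Rightarrow> nat \<Rightarrow> nat \<Rightarrow> nat \<times> nat \<Rightarrow> bool" where
  "is_RMaxSS A i j = (\<lambda>(i', j'). (i', j') \<in> max_sum_segments A i j \<and>
     (\<forall>(k, l) \<in> max_sum_segments A i j. j' - i' < l - k \<or> j' - i' = l - k \<and> k \<le> i'))"

text \<open>The empty range is represented by \<open>None\<close>. The definite description is
  justified by the lemma \<open>ex1_is_RMaxSS\<close> below.\<close>

definition RMaxSSQ :: "real list \<Rightarrow> nat \<Rightarrow> nat \<Rightarrow> (nat \<times> nat) option" where
  "RMaxSSQ A i j =
     (if \<forall>k \<in> {i..j}. A ! (k - 1) \<le> 0 then None else Some (THE p. is_RMaxSS A i j p))"

lemma ex1_is_RMaxSS:
  assumes "i \<le> j"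
  shows "\<exists>!p. is_RMaxSS A i j p"
proof -
  let ?M = "max_sum_segments A i j"
  have fin: "finite (subranges i j)"
    by (rule finite_subset[of _ "{..j} \<times> {..j}"]) (auto simp: subranges_def)
  have ne: "subranges i j \<noteq> {}"
    using assms by (auto simp: subranges_def)
  have finM: "finite ?M"
    by (rule finite_subset[OF _ fin]) (auto simp: max_sum_segments_def)
  have "Max ((\<lambda>(k, l). seg_sum A k l) ` subranges i j) \<in> (\<lambda>(k, l). seg_sum A k l) ` subranges i j"
    using fin ne by (intro Max_in) auto
  then obtain a b where ab: "(a, b) \<in> subranges i j"
    and eq: "seg_sum A a b = Max ((\<lambda>(k, l). seg_sum A k l) ` subranges i j)"
    by auto
  have "seg_sum A k l \<le> seg_sum A a b" if "(k, l) \<in> subranges i j" for k l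
    unfolding eq using fin that by (intro Max_ge) force+
  with ab have "(a, b) \<in> ?M"
    by (auto simp: max_sum_segments_def)
  then obtain c d where cd: "(c, d) \<in> ?M"
    and short: "\<And>k l. (k, l) \<in> ?M \<Longrightarrow> d - c \<le> l - k"
    using ex_min_if_finite[of "(\<lambda>(k, l). l - k) ` ?M"] finM by fastforce
  let ?N = "{k. (k, k + (d - c)) \<in> ?M}"
  have M_le: "k \<le> l" if "(k, l) \<in> ?M" for k l
    using that by (auto simp: max_sum_segments_def subranges_def)
  have finN: "finite ?N"
    by (rule finite_subset[of _ "{..j}"]) (auto simp: max_sum_segments_def subranges_def)
  have neN: "c \<in> ?N"
    using cd M_le[OF cd] by simp
  let ?m = "Max ?N"
  have m: "?m \<in> ?N"
    using finN neN by (intro Max_in) auto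
  have "is_RMaxSS A i j (?m, ?m + (d - c))"
    unfolding is_RMaxSS_def
  proof (clarsimp, intro conjI ballI)
    show "(?m, ?m + (d - c)) \<in> ?M"
      using m by simp
  next
    fix p assume p: "p \<in> ?M"
    obtain k l where kl: "p = (k, l)" by (cases p)
    have "k \<le> ?m" if "d - c = l - k"
      using finN that p M_le[of k l] kl by (intro Max_ge) auto
    then show "case p of (k, l) \<Rightarrow> d - c < l - k \<or> d - c = l - k \<and> k \<le> ?m"
      using short[of k l] p kl by auto
  qed
  moreover have "p = q" if "is_RMaxSS A i j p" "is_RMaxSS A i j q" for p q
    using that M_le[of "fst p" "snd p"] M_le[of "fst q" "snd q"]
    by (cases p; cases q) (fastforce simp: is_RMaxSS_def)
  ultimately show ?thesis
    by blast
qed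

text \<open>A data structure for arrays of length \<open>n\<close> consists of an encoder \<open>enc\<close>, mapping each
  array to the bits that are stored, and a query algorithm \<open>query\<close>, which sees the stored
  bits and the query only.\<close>

definition encodes_RMaxSSQ ::
    "nat \<Rightarrow> (real list \<Rightarrow> bool list) \<Rightarrow> (bool list \<Rightarrow> nat \<Rightarrow> nat \<Rightarrow> (nat \<times> nat) option) \<Rightarrow> bool"
  where
  "encodes_RMaxSSQ n enc query \<longleftrightarrow>
     (\<forall>A i j. length A = n \<longrightarrow> 1 \<le> i \<longrightarrow> i \<le> j \<longrightarrow> j \<le> n \<longrightarrow>
        query (enc A) i j = RMaxSSQ A i j)"

end

theory Submission
  imports Defs
begin

text \<open>An array is represented by its prefix sums \<open>P 0, \<dots>, P n\<close>, so that a query asks for the largest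
  rise \<open>P y - P x\<close>, \<open>x < y\<close>, in a window. When a point \<open>P (k + 1)\<close> is appended, the answer for the
  window starting at \<open>i\<close> becomes a segment ending at the new point iff \<open>P (k + 1)\<close> exceeds
  the threshold \<open>lo P i k + rise P i k\<close>. Hence an array whose thresholds take \<open>d\<close> distinct values has at
  least \<open>d + 1\<close> distinguishable extensions by one entry. Counting only thresholds of windows that
  contain the global minimum, and writing \<open>a + 1\<close> for the number of window minima that share
  the lowest threshold, exceeding the \<open>s\<close> lowest thresholds leads from \<open>(d, a)\<close> to \<open>(d + 1 - s, a + 1)\<close>,
  whereas a drop below all earlier points aligns all window minima, which turns
  distinct rises into distinct thresholds and leads to \<open>(d + a, 0)\<close>. This growth process
  has more than \<open>c (15/4)\<^sup>n\<close> outcomes, and \<open>15/4 > 2 powr 1.9\<close>.\<close>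

section \<open>Window minima, largest rises and thresholds of prefix-sum sequences\<close>

primrec lo :: "(nat \<Rightarrow> real) \<Rightarrow> nat \<Rightarrow> nat \<Rightarrow> real" where
  "lo P i 0 = P 0"
| "lo P i (Suc k) = (if i \<le> k then min (lo P i k) (P (Suc k)) else P (Suc k))"

primrec rise :: "(nat \<Rightarrow> real) \<Rightarrow> nat \<Rightarrow> nat \<Rightarrow> real" where
  "rise P i 0 = 0"
| "rise P i (Suc k) = (if i \<le> k then max (rise P i k) (P (Suc k) - lo P i k) else 0)"

definition thr :: "(nat \<Rightarrow> real) \<Rightarrow> nat \<Rightarrow> nat \<Rightarrow> real" where
  "thr P i k = lo P i k + rise P i k"

lemma lo_le: "i \<le> x \<Longrightarrow> x \<le> k \<Longrightarrow> lo P i k \<le> P x"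
  by (induction k) (auto simp: le_Suc_eq min_le_iff_disj)

lemma lo_attained: "i \<le> k \<Longrightarrow> \<exists>x. i \<le> x \<and> x \<le> k \<and> lo P i k = P x"
proof (induction k)
  case (Suc k)
  show ?case
  proof (cases "i \<le> k")
    case True
    then obtain x where "i \<le> x" "x \<le> k" "lo P i k = P x"
      using Suc.IH by blast
    have "lo P i (Suc k) = P x \<or> lo P i (Suc k) = P (Suc k)"
      using True \<open>lo P i k = P x\<close> by auto
    with \<open>i \<le> x\<close> \<open>x \<le> k\<close> Suc.prems show ?thesis
      by (meson le_Suc_eq order_refl)
  qed (use Suc.prems in auto)
qed auto

lemma rise_nonneg: "0 \<le> rise P i k"
  by (induction k) auto

lemma rise_ge: "i \<le> x \<Longrightarrow> x \<le> y \<Longrightarrow> y \<le> k \<Longrightarrow> P y - P x \<le> rise P i k"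
proof (induction k)
  case (Suc k)
  show ?case
  proof (cases "y \<le> k")
    case True
    then show ?thesis using Suc by auto
  next
    case False
    then have y: "y = Suc k" using Suc.prems by auto
    show ?thesis
    proof (cases "x = y")
      case True
      then show ?thesis using rise_nonneg[of P i "Suc k"] by simp
    next
      case False
      then show ?thesis using y Suc.prems lo_le[of i x k P] by auto
    qed
  qed
qed auto

lemma rise_attained: "i \<le> k \<Longrightarrow> \<exists>x y. i \<le> x \<and> x \<le> y \<and> y \<le> k \<and> rise P i k = P y - P x"
proof (induction k)
  case (Suc k)
  show ?case
  proof (cases "i \<le> k")
    case True
    then obtain x y where xy: "i \<le> x" "x \<le> y" "y \<le> k" "rise P i k = P y - P x"
      using Suc.IH by blast
    obtain z where z: "i \<le> z" "z \<le> k" "lo P i k = P z"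
      using lo_attained[OF True] by blast
    show ?thesis
    proof (cases "rise P i k \<ge> P (Suc k) - lo P i k")
      case True
      with xy \<open>i \<le> k\<close> show ?thesis by (auto simp: max_def intro: le_SucI)
    next
      case False
      with z \<open>i \<le> k\<close> show ?thesis
        by (intro exI[of _ z] exI[of _ "Suc k"]) auto
    qed
  qed (use Suc.prems in auto)
qed auto

lemma lo_cong: "(\<And>x. x \<le> k \<Longrightarrow> P x = Q x) \<Longrightarrow> lo P i k = lo Q i k"
  by (induction k) auto

lemma rise_cong: "(\<And>x. x \<le> k \<Longrightarrow> P x = Q x) \<Longrightarrow> rise P i k = rise Q i k"
proof (induction k)
  case (Suc k)
  then show ?case using lo_cong[of k P Q i] by auto
qed auto

lemma thr_cong: "(\<And>x. x \<le> k \<Longrightarrow> P x = Q x) \<Longrightarrow> thr P i k = thr Q i k"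
  unfolding thr_def using lo_cong rise_cong by metis

text \<open>The climb from the window minimum to the last point is itself one of the rises. So
  \<open>P k\<close> is the least possible threshold, and the window \<open>i = k\<close> attains
  it.\<close>

lemma thr_ge: "i \<le> k \<Longrightarrow> P k \<le> thr P i k"
proof -
  assume i: "i \<le> k"
  then obtain z where z: "i \<le> z" "z \<le> k" "lo P i k = P z"
    using lo_attained by blast
  then show ?thesis
    unfolding thr_def using rise_ge[of i z k k P] by simp
qed

text \<open>A pair \<open>(i, j)\<close> stands for the query from \<open>Suc i\<close> to
  \<open>j\<close>, as entry \<open>Suc i\<close> leads from point \<open>i\<close> to the next one.
  For generic \<open>P\<close> these are the queries whose answer touches their right end, and it is
  these patterns that get counted.\<close>

definition ends :: "(nat \<Rightarrow> real) \<Rightarrow> nat \<Rightarrow> (nat \<times> nat) set" where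
  "ends P n = {(i, j). i < j \<and> j \<le> n \<and> thr P i (j - 1) < P j}"

text \<open>Without equality at a threshold, a segment ending at \<open>j\<close> and an earlier one
  never tie for the maximum, so the tie-breaking rule cannot affect the pattern.\<close>

definition generic :: "(nat \<Rightarrow> real) \<Rightarrow> nat \<Rightarrow> bool" where
  "generic P n \<longleftrightarrow> (\<forall>i j. i < j \<and> j \<le> n \<longrightarrow> P j \<noteq> thr P i (j - 1))"

lemma generic_upd:
  assumes "generic P k" "\<And>i. i \<le> k \<Longrightarrow> y \<noteq> thr P i k"
  shows "generic (P(Suc k := y)) (Suc k)"
  unfolding generic_def
proof (intro allI impI)
  fix i j assume ij: "i < j \<and> j \<le> Suc k"
  have t: "thr (P(Suc k := y)) i (j - 1) = thr P i (j - 1)"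
    using ij by (intro thr_cong) auto
  show "(P(Suc k := y)) j \<noteq> thr (P(Suc k := y)) i (j - 1)"
    unfolding t using assms ij by (cases "j = Suc k") (auto simp: generic_def)
qed

subsection \<open>From queries to thresholds\<close>

definition arr :: "(nat \<Rightarrow> real) \<Rightarrow> nat \<Rightarrow> real list" where
  "arr P n = map (\<lambda>k. P (Suc k) - P k) [0..<n]"

lemma length_arr [simp]: "length (arr P n) = n"
  by (simp add: arr_def)

lemma seg_sum_arr:
  assumes "1 \<le> i" "i \<le> j" "j \<le> n"
  shows "seg_sum (arr P n) i j = P j - P (i - 1)"
proof -
  have "seg_sum (arr P n) i j = (\<Sum>k = i..j. P k - P (k - 1))"
    unfolding seg_sum_def using assms by (intro sum.cong) (auto simp: arr_def)
  also have "\<dots> = P j - P (i - 1)"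
    using assms(2) by (induction j rule: dec_induct) auto
  finally show ?thesis .
qed

lemma RMaxSSQ_SomeD:
  assumes "RMaxSSQ A i j = Some p" "i \<le> j"
  shows "p \<in> max_sum_segments A i j"
proof -
  have "p = (THE p. is_RMaxSS A i j p)"
    using assms(1) by (auto simp: RMaxSSQ_def split: if_splits)
  then have "is_RMaxSS A i j p"
    using theI'[OF ex1_is_RMaxSS[OF assms(2)]] by metis
  then show ?thesis
    by (auto simp: is_RMaxSS_def)
qed

text \<open>The best segment ending at \<open>j\<close> has sum \<open>P j - lo P i (j - 1)\<close>,
  while those ending earlier reach at most \<open>rise P i (j - 1)\<close>. The pattern is thus
  readable from the answers alone.\<close>

lemma RMaxSSQ_arr_ends_iff:
  assumes ij: "i < j" "j \<le> n" and neq: "P j \<noteq> thr P i (j - 1)"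
  shows "(\<exists>a. RMaxSSQ (arr P n) (Suc i) j = Some (a, j)) \<longleftrightarrow> thr P i (j - 1) < P j"
proof -
  let ?A = "arr P n"
  have ij': "i \<le> j - 1" using ij by simp
  have seg: "seg_sum ?A a b = P b - P (a - 1)" if "Suc i \<le> a" "a \<le> b" "b \<le> j" for a b
    using that ij by (intro seg_sum_arr) auto
  have bound: "P y - P x \<le> P b - P (a - 1)"
    if "(a, b) \<in> max_sum_segments ?A (Suc i) j" "i \<le> x" "x < y" "y \<le> j" for a b x y
  proof -
    have ab: "Suc i \<le> a" "a \<le> b" "b \<le> j"
      and le: "\<And>k l. (k, l) \<in> subranges (Suc i) j \<Longrightarrow> seg_sum ?A k l \<le> seg_sum ?A a b"
      using that(1) by (auto simp: max_sum_segments_def subranges_def)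
    have "(Suc x, y) \<in> subranges (Suc i) j"
      using that by (auto simp: subranges_def)
    from le[OF this] show ?thesis
      using seg[of a b] seg[of "Suc x" y] ab that by simp
  qed
  obtain x where x: "i \<le> x" "x \<le> j - 1" "lo P i (j - 1) = P x"
    using lo_attained[OF ij'] by blast
  show ?thesis
  proof
    assume less: "thr P i (j - 1) < P j"
    then have gt: "rise P i (j - 1) < P j - P x"
      using x(3) by (simp add: thr_def)
    have "\<not> (\<forall>k \<in> {Suc i..j}. ?A ! (k - 1) \<le> 0)"
    proof
      assume "\<forall>k \<in> {Suc i..j}. ?A ! (k - 1) \<le> 0"
      then have "seg_sum ?A (Suc x) j \<le> 0"
        unfolding seg_sum_def using x by (intro sum_nonpos) auto
      then show False
        using seg[of "Suc x" j] x ij gt rise_nonneg[of P i "j - 1"] by simp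
    qed
    then obtain a b where ab: "RMaxSSQ ?A (Suc i) j = Some (a, b)"
      unfolding RMaxSSQ_def by (metis surj_pair)
    then have m: "(a, b) \<in> max_sum_segments ?A (Suc i) j"
      using ij by (intro RMaxSSQ_SomeD) auto
    then have ab': "Suc i \<le> a" "a \<le> b" "b \<le> j"
      by (auto simp: max_sum_segments_def subranges_def)
    have "b = j"
    proof (rule ccontr)
      assume "b \<noteq> j"
      then have "P b - P (a - 1) \<le> rise P i (j - 1)"
        using ab' by (intro rise_ge) auto
      moreover have "x < j" using x ij by simp
      ultimately show False
        using bound[OF m, of x j] x gt by simp
    qed
    with ab show "\<exists>a. RMaxSSQ ?A (Suc i) j = Some (a, j)" by blast
  next
    assume "\<exists>a. RMaxSSQ ?A (Suc i) j = Some (a, j)"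
    then obtain a where a: "RMaxSSQ ?A (Suc i) j = Some (a, j)" by blast
    then have m: "(a, j) \<in> max_sum_segments ?A (Suc i) j"
      using ij by (intro RMaxSSQ_SomeD) auto
    then have a': "Suc i \<le> a" "a \<le> j"
      by (auto simp: max_sum_segments_def subranges_def)
    have le: "P j - P (a - 1) \<le> P j - lo P i (j - 1)"
      using lo_le[of i "a - 1" "j - 1" P] a' by simp
    show "thr P i (j - 1) < P j"
    proof (rule ccontr)
      assume "\<not> ?thesis"
      then have gt: "P j - lo P i (j - 1) < rise P i (j - 1)"
        using neq by (simp add: thr_def)
      obtain u v where uv: "i \<le> u" "u \<le> v" "v \<le> j - 1" "rise P i (j - 1) = P v - P u"
        using rise_attained[OF ij'] by blast
      show False
      \<comment> \<open>For \<open>u < v\<close> the segment from \<open>Suc u\<close> to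
        \<open>v\<close> beats the answer. For \<open>u = v\<close> the rise is 0 and the answer has
        negative sum, yet a nonempty answer requires a positive entry, which alone does
        better.\<close>
      proof (cases "u = v")
        case False
        then have "P v - P u \<le> P j - P (a - 1)"
          using uv by (intro bound[OF m]) auto
        then show False using uv le gt by simp
      next
        case True
        then have neg: "P j - P (a - 1) < 0" using uv le gt by simp
        obtain k where k: "k \<in> {Suc i..j}" "?A ! (k - 1) > 0"
          using a by (auto simp: RMaxSSQ_def not_le split: if_splits)
        then have "0 < P k - P (k - 1)"
          using ij by (auto simp: arr_def)
        with bound[OF m, of "k - 1" k] k neg show False by force
      qed
    qed
  qed
qed

subsection \<open>Extending an array by one entry\<close>

text \<open>These windows share one minimum, so their distinct thresholds amount to distinct
  rises.\<close>

definition lev :: "(nat \<Rightarrow> real) \<Rightarrow> nat \<Rightarrow> real set" where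
  "lev P k = (\<lambda>i. thr P i k) ` {i. i \<le> k \<and> lo P i k = lo P 0 k}"

text \<open>A window at the lowest threshold \<open>P k\<close> has rise
  \<open>P k - lo P i k\<close>, so distinct minima here are distinct rises, hidden behind one
  common threshold until a drop separates them.\<close>

definition low_mins :: "(nat \<Rightarrow> real) \<Rightarrow> nat \<Rightarrow> real set" where
  "low_mins P k = (\<lambda>i. lo P i k) ` {i. i \<le> k \<and> thr P i k = P k}"

definition state :: "(nat \<Rightarrow> real) \<Rightarrow> nat \<Rightarrow> nat \<Rightarrow> nat \<Rightarrow> bool" where
  "state P k d a \<longleftrightarrow> generic P k \<and> d \<le> card (lev P k) \<and> Suc a \<le> card (low_mins P k)"

lemma finite_lev: "finite (lev P k)" and finite_low_mins: "finite (low_mins P k)"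
  by (auto simp: lev_def low_mins_def)

lemma lev_ge: "v \<in> lev P k \<Longrightarrow> P k \<le> v"
  by (auto simp: lev_def thr_ge)

text \<open>Levels give rises of at least \<open>P k - m\<close>, and windows in
  \<open>low_mins\<close> with minimum above \<open>m\<close> give rises strictly below that. The
  two families are disjoint, and discarding the minimum \<open>m\<close> costs at most one element,
  whence \<open>Suc a\<close> in \<open>state\<close>.\<close>

lemma card_rise_ge:
  assumes "state P k d a"
  shows "d + a \<le> card ((\<lambda>i. rise P i k) ` {..k})"
proof -
  define m where "m = lo P 0 k"
  let ?X = "(\<lambda>v. v - m) ` lev P k"
  let ?Y = "(\<lambda>u. P k - u) ` (low_mins P k - {m})"
  have "?X \<subseteq> (\<lambda>i. rise P i k) ` {..k}"
    by (auto simp: lev_def thr_def m_def)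
  moreover have "?Y \<subseteq> (\<lambda>i. rise P i k) ` {..k}"
  proof
    fix w assume "w \<in> ?Y"
    then obtain i where i: "i \<le> k" "thr P i k = P k" "w = P k - lo P i k"
      by (auto simp: low_mins_def)
    then have "w = rise P i k" by (simp add: thr_def)
    with i show "w \<in> (\<lambda>i. rise P i k) ` {..k}" by blast
  qed
  ultimately have "card (?X \<union> ?Y) \<le> card ((\<lambda>i. rise P i k) ` {..k})"
    by (intro card_mono) auto
  moreover have "?X \<inter> ?Y = {}"
  proof -
    have "v - m \<noteq> P k - u" if v: "v \<in> lev P k" and u: "u \<in> low_mins P k" "u \<noteq> m" for u v
    proof -
      obtain i where i: "i \<le> k" "u = lo P i k"
        using u(1) unfolding low_mins_def by blast
      obtain z where "i \<le> z" "z \<le> k" "lo P i k = P z"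
        using lo_attained[OF i(1)] by blast
      then have "m \<le> u"
        using lo_le[of 0 z k P] i by (simp add: m_def)
      then show ?thesis using lev_ge[OF v] u(2) by simp
    qed
    then show ?thesis by blast
  qed
  then have "card (?X \<union> ?Y) = card ?X + card ?Y"
    using finite_lev finite_low_mins by (intro card_Un_disjoint) auto
  moreover have "card ?X = card (lev P k)"
    by (intro card_image) (auto simp: inj_on_def)
  moreover have "card ?Y = card (low_mins P k - {m})"
    by (intro card_image) (auto simp: inj_on_def)
  moreover have "card (low_mins P k) - 1 \<le> card (low_mins P k - {m})"
    by (simp add: card_Diff_singleton_if)
  ultimately show ?thesis
    using assms by (auto simp: state_def)
qed

text \<open>The new point becomes the minimum of every window and changes no earlier rise, so all
  thresholds are \<open>y\<close> plus a rise and all these windows count for \<open>lev\<close>.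
  The one-point window supplies the single element of \<open>low_mins\<close> that is
  claimed.\<close>

lemma state_drop:
  assumes st: "state P k d a" and y: "y < lo P 0 k"
  shows "state (P(Suc k := y)) (Suc k) (d + a) 0"
proof -
  let ?Q = "P(Suc k := y)"
  have lo_same: "lo ?Q i k = lo P i k" and rise_same: "rise ?Q i k = rise P i k" for i
    by (auto intro!: lo_cong rise_cong)
  have y_less: "y < P x" if "x \<le> k" for x
    using y lo_le[of 0 x k P] that by simp
  have y_lo: "y < lo P i k" if "i \<le> k" for i
    using lo_attained[OF that, of P] y_less by auto
  have lo_Q: "lo ?Q i (Suc k) = y" for i
    using y_lo[of i] by (auto simp: lo_same)
  have rise_Q: "rise ?Q i (Suc k) = rise P i k" if "i \<le> k" for i
    using y_lo[OF that] rise_nonneg[of P i k] that by (simp add: lo_same rise_same)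
  have "generic ?Q (Suc k)"
  proof (rule generic_upd)
    show "generic P k" using st by (simp add: state_def)
    show "y \<noteq> thr P i k" if "i \<le> k" for i
      using y_less[of k] thr_ge[OF that, of P] by simp
  qed
  moreover have "d + a \<le> card (lev ?Q (Suc k))"
  proof -
    have "y + rise P i k \<in> lev ?Q (Suc k)" if "i \<le> k" for i
      unfolding lev_def thr_def using lo_Q[of i] lo_Q[of 0] rise_Q[OF that] that
      by (intro image_eqI[of _ _ i]) (simp_all del: lo.simps rise.simps)
    then have "(\<lambda>r. y + r) ` (\<lambda>i. rise P i k) ` {..k} \<subseteq> lev ?Q (Suc k)"
      by auto
    then have "card ((\<lambda>r. y + r) ` (\<lambda>i. rise P i k) ` {..k}) \<le> card (lev ?Q (Suc k))"
      by (intro card_mono finite_lev)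
    moreover have "card ((\<lambda>r. y + r) ` (\<lambda>i. rise P i k) ` {..k}) = card ((\<lambda>i. rise P i k) ` {..k})"
      by (intro card_image) (auto simp: inj_on_def)
    ultimately show ?thesis using card_rise_ge[OF st] by simp
  qed
  moreover have "Suc 0 \<le> card (low_mins ?Q (Suc k))"
  proof -
    have "y \<in> low_mins ?Q (Suc k)"
      unfolding low_mins_def by (intro image_eqI[of _ _ "Suc k"]) (auto simp: thr_def)
    then show ?thesis
      using finite_low_mins[of ?Q "Suc k"] by (auto simp: Suc_le_eq card_gt_0_iff)
  qed
  ultimately show ?thesis by (simp add: state_def)
qed

text \<open>As \<open>s\<close> is positive, \<open>y\<close> exceeds \<open>P k\<close>, so old
  minima persist and each threshold becomes its maximum with \<open>y\<close>. The \<open>s\<close>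
  levels below \<open>y\<close> merge into the one level \<open>y\<close>. The windows formerly at
  \<open>P k\<close> now sit at \<open>y\<close>, joined by the one-point window with the new
  minimum \<open>y\<close>.\<close>

lemma state_up:
  assumes st: "state P k d a" and s: "1 \<le> s" "s \<le> d"
    and card_y: "card {v \<in> lev P k. v < y} = s" and ny: "\<And>i. i \<le> k \<Longrightarrow> y \<noteq> thr P i k"
  shows "state (P(Suc k := y)) (Suc k) (Suc d - s) (Suc a)"
proof -
  let ?Q = "P(Suc k := y)"
  have lo_same: "lo ?Q i k = lo P i k" and rise_same: "rise ?Q i k = rise P i k" for i
    by (auto intro!: lo_cong rise_cong)
  have "{v \<in> lev P k. v < y} \<noteq> {}"
    using card_y s by (metis card.empty not_one_le_zero)
  then obtain i0 where i0: "i0 \<le> k" "lo P i0 k = lo P 0 k" "thr P i0 k < y"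
    by (auto simp: lev_def)
  then have Pk: "P k < y"
    using thr_ge[of i0 k P] by simp
  have lo_Q: "lo ?Q i (Suc k) = lo P i k" if "i \<le> k" for i
    using lo_le[of i k k P] that Pk by (simp add: lo_same)
  have thr_Q: "thr ?Q i (Suc k) = max (thr P i k) y" if "i \<le> k" for i
    using lo_Q[OF that] that by (auto simp: thr_def rise_same lo_same)
  have Q_last: "lo ?Q (Suc k) (Suc k) = y" "thr ?Q (Suc k) (Suc k) = y"
    by (auto simp: thr_def)
  have "generic ?Q (Suc k)"
    using st ny by (intro generic_upd) (auto simp: state_def)
  moreover have "Suc d - s \<le> card (lev ?Q (Suc k))"
  proof -
    have "y \<notin> lev P k"
      using ny by (auto simp: lev_def)
    then have split: "lev P k = {v \<in> lev P k. v < y} \<union> {v \<in> lev P k. y < v}"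
      by (auto simp: not_less_iff_gr_or_eq)
    have "card (lev P k) = s + card {v \<in> lev P k. y < v}"
      by (subst split, subst card_Un_disjoint) (auto simp: finite_lev card_y)
    moreover have "insert y {v \<in> lev P k. y < v} \<subseteq> lev ?Q (Suc k)"
    proof -
      have mem: "max (thr P i k) y \<in> lev ?Q (Suc k)" if "i \<le> k" "lo P i k = lo P 0 k" for i
        unfolding lev_def using that thr_Q[of i] lo_Q[of i] lo_Q[of 0]
        by (intro image_eqI[of _ _ i]) (auto simp del: lo.simps)
      show ?thesis
        using mem[OF i0(1,2)] i0(3) mem by (fastforce simp: lev_def max_def)
    qed
    then have "card (insert y {v \<in> lev P k. y < v}) \<le> card (lev ?Q (Suc k))"
      by (intro card_mono finite_lev)
    moreover have "card (insert y {v \<in> lev P k. y < v}) = Suc (card {v \<in> lev P k. y < v})"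
      by (simp add: finite_lev)
    moreover have "d \<le> card (lev P k)"
      using st by (simp add: state_def)
    ultimately show ?thesis by linarith
  qed
  moreover have "Suc (Suc a) \<le> card (low_mins ?Q (Suc k))"
  proof -
    have sub: "insert y (low_mins P k) \<subseteq> low_mins ?Q (Suc k)"
    proof -
      have "lo P i k \<in> low_mins ?Q (Suc k)" if "i \<le> k" "thr P i k = P k" for i
        unfolding low_mins_def using that thr_Q[of i] lo_Q[of i] Pk
        by (intro image_eqI[of _ _ i]) (auto simp del: lo.simps)
      moreover have "y \<in> low_mins ?Q (Suc k)"
        unfolding low_mins_def using Q_last
        by (intro image_eqI[of _ _ "Suc k"]) (auto simp del: lo.simps)
      ultimately show ?thesis by (auto simp: low_mins_def)
    qed
    have "y \<notin> low_mins P k"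
      using lo_le[of _ k k P] Pk by (fastforce simp: low_mins_def)
    then have "Suc (card (low_mins P k)) \<le> card (low_mins ?Q (Suc k))"
      using card_mono[OF finite_low_mins sub] by (simp add: finite_low_mins)
    then show ?thesis using st by (simp add: state_def)
  qed
  ultimately show ?thesis by (simp add: state_def)
qed

lemma ex_real_with_card_below:
  fixes G F :: "real set"
  assumes "finite G" "finite F" "s \<le> card G"
  shows "\<exists>y. y \<notin> F \<and> card {v \<in> G. v < y} = s"
  using assms(3)
proof (induction s)
  case 0
  define y where "y = Min (insert 0 (F \<union> G)) - 1"
  have y: "y < v" if "v \<in> F \<union> G" for v
  proof -
    have "Min (insert 0 (F \<union> G)) \<le> v"
      using that assms by (intro Min_le) auto
    then show ?thesis by (simp add: y_def)
  qed
  then have "{v \<in> G. v < y} = {}" by force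
  then have "card {v \<in> G. v < y} = 0" by (metis card.empty)
  moreover have "y \<notin> F" using y by blast
  ultimately show ?case by blast
next
  case (Suc s)
  then obtain y where y: "y \<notin> F" "card {v \<in> G. v < y} = s" by auto
  let ?U = "{v \<in> G. y \<le> v}"
  have finU: "finite ?U" using assms by simp
  have neU: "?U \<noteq> {}"
  proof
    assume "?U = {}"
    then have "{v \<in> G. v < y} = G" by auto
    with y Suc.prems show False by simp
  qed
  define u where "u = Min ?U"
  have u: "u \<in> G" "y \<le> u" and u_min: "\<And>v. v \<in> G \<Longrightarrow> y \<le> v \<Longrightarrow> u \<le> v"
    using Min_in[OF finU neU] finU by (auto simp: u_def)
  \<comment> \<open>A point just above \<open>u\<close> passes exactly one more element of
    \<open>G\<close> and avoids \<open>F\<close> if it stays below all larger elements of both sets;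
    \<open>u + 1\<close> keeps the set nonempty.\<close>
  let ?W = "insert (u + 1) {w \<in> F \<union> G. u < w}"
  have "u < Min ?W"
    using assms by (subst Min_gr_iff) auto
  then obtain z where z: "u < z" "z < Min ?W"
    using dense by blast
  have zW: "z < w" if "w \<in> F \<union> G" "u < w" for w
    using z(2) that assms by (subst (asm) Min_gr_iff) auto
  have "{v \<in> G. v < z} = insert u {v \<in> G. v < y}"
    using u u_min z(1) zW by fastforce
  moreover have "z \<notin> F" using zW z(1) by blast
  ultimately show ?case
    using y u assms by (intro exI[of _ z]) auto
qed

subsection \<open>Counting the reachable answer patterns\<close>

text \<open>A truncated and rounded Perron eigenvector of the transitions
  \<open>(d, a) \<mapsto> (1, a + 1), \<dots>, (d, a + 1), (d + a, 0)\<close>.\<close>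

definition weight :: "nat \<Rightarrow> nat \<Rightarrow> nat" where
  "weight d a = [[0, 0, 0, 0], [1, 3, 7, 12], [5, 11, 20, 29], [15, 28, 44, 56],
     [35, 56, 76, 76], [69, 96, 103, 103], [116, 132, 139, 139]] ! min d 6 ! min a 3"

lemma weight_min: "weight (min d 6) (min a 3) = weight d a"
  by (simp add: weight_def)

lemma weight_le: "weight d a \<le> 139"
proof -
  have "weight x y \<le> 139" if "x \<in> {0, 1, 2, 3, 4, 5, 6}" "y \<in> {0, 1, 2, 3}" for x y
    using that by (elim insertE emptyE; simp only:; simp add: weight_def)
  moreover have "min d 6 \<in> {0, 1, 2, 3, 4, 5, 6}" "min a 3 \<in> {0, 1, 2, 3}"
    by auto
  ultimately show ?thesis
    using weight_min by metis
qed

lemma weight_mono_left: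
  assumes "x \<le> y"
  shows "weight x 0 \<le> weight y 0"
proof -
  have w: "weight x 0 \<le> weight y 0"
    if "x \<in> {0, 1, 2, 3, 4, 5, 6}" "y \<in> {0, 1, 2, 3, 4, 5, 6}" "x \<le> y" for x y
    using that by (elim insertE emptyE; simp only:; simp add: weight_def)
  have "weight (min x 6) 0 \<le> weight (min y 6) 0"
    using assms by (intro w) auto
  then show ?thesis by (simp add: weight_def)
qed

text \<open>This inequality certifies the growth factor 15/4. Truncating \<open>d\<close> and
  \<open>a\<close> leaves the left side unchanged and can only decrease the right side, so 28
  numerical cases suffice.\<close>

lemma weight_step: "15 * weight d a \<le> 4 * ((\<Sum>j = 1..d. weight j (Suc a)) + weight (d + a) 0)"
proof -
  let ?d = "min d 6" and ?a = "min a 3"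
  have ivl: "{1..0::nat} = {}" "{1..1::nat} = {1}" "{1..2::nat} = {1, 2}" "{1..3::nat} = {1, 2, 3}"
    "{1..4::nat} = {1, 2, 3, 4}" "{1..5::nat} = {1, 2, 3, 4, 5}" "{1..6::nat} = {1, 2, 3, 4, 5, 6}"
    by auto
  have step: "15 * weight x y \<le> 4 * ((\<Sum>j \<in> {1..x}. weight j (Suc y)) + weight (x + y) 0)"
    if "x \<in> {0, 1, 2, 3, 4, 5, 6}" "y \<in> {0, 1, 2, 3}" for x y
    using that by (elim insertE emptyE; simp only: ivl; simp add: weight_def)
  have "15 * weight ?d ?a \<le> 4 * ((\<Sum>j = 1..?d. weight j (Suc ?a)) + weight (?d + ?a) 0)"
    by (rule step) auto
  moreover have "(\<Sum>j = 1..?d. weight j (Suc ?a)) \<le> (\<Sum>j = 1..d. weight j (Suc a))"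
  proof -
    have "min (Suc ?a) 3 = min (Suc a) 3" by auto
    then have "(\<Sum>j = 1..?d. weight j (Suc ?a)) = (\<Sum>j = 1..?d. weight j (Suc a))"
      by (simp only: weight_def)
    also have "\<dots> \<le> (\<Sum>j = 1..d. weight j (Suc a))"
      by (intro sum_mono2) auto
    finally show ?thesis .
  qed
  moreover have "weight (?d + ?a) 0 \<le> weight (d + a) 0"
    by (intro weight_mono_left) auto
  ultimately show ?thesis
    unfolding weight_min by (meson add_mono le_trans mult_le_mono2)
qed

definition ends_ext :: "(nat \<Rightarrow> real) \<Rightarrow> nat \<Rightarrow> nat \<Rightarrow> (nat \<times> nat) set set" where
  "ends_ext P k m = {ends Q (k + m) | Q. (\<forall>x \<le> k. Q x = P x) \<and> generic Q (k + m)}"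

lemma finite_ends_ext: "finite (ends_ext P k m)"
  by (rule finite_subset[of _ "Pow ({..k + m} \<times> {..k + m})"]) (auto simp: ends_ext_def ends_def)

lemma ends_ext_upd_subset: "ends_ext (P(Suc k := y)) (Suc k) m \<subseteq> ends_ext P k (Suc m)"
  unfolding ends_ext_def by fastforce

text \<open>Membership of \<open>(i, Suc k)\<close> depends on the points up to \<open>Suc k\<close>
  only, so every further extension still reveals which thresholds that point exceeded.\<close>

lemma ends_ext_last:
  assumes "E \<in> ends_ext (P(Suc k := y)) (Suc k) m" "i \<le> k"
  shows "(i, Suc k) \<in> E \<longleftrightarrow> thr P i k < y"
proof -
  obtain Q where Q: "E = ends Q (Suc k + m)" "\<And>x. x \<le> Suc k \<Longrightarrow> Q x = (P(Suc k := y)) x"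
    using assms(1) by (auto simp: ends_ext_def)
  have "thr Q i k = thr P i k"
    using Q(2) by (intro thr_cong) auto
  with Q assms(2) show ?thesis by (simp add: ends_def)
qed

text \<open>Each of the \<open>d + 1\<close> choices for the next point leads to a state covered by
  the induction hypothesis; the resulting pattern sets are disjoint, and \<open>weight_step\<close>
  adds up their bounds.\<close>

lemma card_ends_ext_ge:
  "state P k d a \<Longrightarrow> 15 ^ m * weight d a \<le> 139 * 4 ^ m * card (ends_ext P k m)"
proof (induction m arbitrary: P k d a)
  case 0
  have "ends P k \<in> ends_ext P k 0"
    using 0 by (auto simp: ends_ext_def state_def)
  then have "1 \<le> card (ends_ext P k 0)"
    using finite_ends_ext[of P k 0] by (auto simp: Suc_le_eq card_gt_0_iff)
  \<comment> \<open>The factor 139 is the largest weight, which makes the bound hold with a single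
    pattern.\<close>
  then show ?case
    using weight_le[of d a] by simp
next
  case (Suc m)
  have dcard: "d \<le> card (lev P k)"
    using Suc.prems by (simp add: state_def)
  \<comment> \<open>Avoiding the thresholds of all windows, not just those in \<open>lev\<close>,
    keeps the extension generic.\<close>
  have "\<exists>y. y \<notin> (\<lambda>i. thr P i k) ` {..k} \<and> card {v \<in> lev P k. v < y} = s" if "s \<le> d" for s
    using that dcard by (intro ex_real_with_card_below finite_lev) auto
  then obtain z where z: "\<And>s. s \<le> d \<Longrightarrow> z s \<notin> (\<lambda>i. thr P i k) ` {..k}"
      "\<And>s. s \<le> d \<Longrightarrow> card {v \<in> lev P k. v < z s} = s"
    by metis
  \<comment> \<open>Exceeding no level is not enough for \<open>state_drop\<close>, so choice 0 is
    placed below the global minimum.\<close>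
  define y where "y s = (if s = 0 then lo P 0 k - 1 else z s)" for s
  have y_card: "card {v \<in> lev P k. v < y s} = s" if "s \<le> d" for s
  proof (cases "s = 0")
    case True
    have "\<not> v < y 0" if "v \<in> lev P k" for v
      using lev_ge[OF that] lo_le[of 0 k k P] by (simp add: y_def)
    then have "{v \<in> lev P k. v < y 0} = {}" by blast
    with True show ?thesis by (metis card.empty)
  next
    case False
    with z(2)[OF that] show ?thesis by (simp add: y_def)
  qed
  let ?X = "\<lambda>s. ends_ext (P(Suc k := y s)) (Suc k) m"
  \<comment> \<open>The number of levels exceeded at \<open>Suc k\<close>, recovered from the
    pattern alone, tells the choices apart.\<close>
  define code where
    "code E = card ((\<lambda>i. thr P i k) ` {i. i \<le> k \<and> lo P i k = lo P 0 k \<and> (i, Suc k) \<in> E})" for E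
  have code: "code E = s" if "E \<in> ?X s" "s \<le> d" for E s
  proof -
    have "(\<lambda>i. thr P i k) ` {i. i \<le> k \<and> lo P i k = lo P 0 k \<and> (i, Suc k) \<in> E}
        = {v \<in> lev P k. v < y s}"
      using ends_ext_last[OF that(1)] by (auto simp: lev_def)
    then show ?thesis
      unfolding code_def using y_card[OF that(2)] by simp
  qed
  have "(\<Sum>s = 0..d. card (?X s)) = card (\<Union>s \<in> {0..d}. ?X s)"
  proof (intro card_UN_disjoint[symmetric] ballI impI)
    show "?X s \<inter> ?X t = {}" if "s \<in> {0..d}" "t \<in> {0..d}" "s \<noteq> t" for s t
      using code[of _ s] code[of _ t] that by fastforce
  qed (auto simp: finite_ends_ext)
  also have "\<dots> \<le> card (ends_ext P k (Suc m))"
    using ends_ext_upd_subset by (intro card_mono finite_ends_ext) blast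
  finally have sum_le: "card (?X 0) + (\<Sum>s = 1..d. card (?X s)) \<le> card (ends_ext P k (Suc m))"
    by (simp add: sum.atLeast_Suc_atMost)
  have down: "15 ^ m * weight (d + a) 0 \<le> 139 * 4 ^ m * card (?X 0)"
    using Suc.prems by (intro Suc.IH state_drop) (auto simp: y_def)
  have "15 ^ m * (\<Sum>s = 1..d. weight (Suc d - s) (Suc a)) \<le> 139 * 4 ^ m * (\<Sum>s = 1..d. card (?X s))"
    unfolding sum_distrib_left
  proof (intro sum_mono Suc.IH)
    fix s assume s: "s \<in> {1..d}"
    then have "y s = z s" by (simp add: y_def)
    with z(1)[of s] s have "y s \<noteq> thr P i k" if "i \<le> k" for i
      using that by auto
    then show "state (P(Suc k := y s)) (Suc k) (Suc d - s) (Suc a)"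
      using Suc.prems s y_card by (intro state_up) auto
  qed
  moreover have "(\<Sum>s = 1..d. weight (Suc d - s) (Suc a)) = (\<Sum>j = 1..d. weight j (Suc a))"
    by (subst sum.atLeastAtMost_rev) simp
  ultimately have up:
    "15 ^ m * (\<Sum>j = 1..d. weight j (Suc a)) \<le> 139 * 4 ^ m * (\<Sum>s = 1..d. card (?X s))"
    by simp
  have "15 ^ Suc m * weight d a = 15 ^ m * (15 * weight d a)"
    by simp
  also have "\<dots> \<le> 15 ^ m * (4 * ((\<Sum>j = 1..d. weight j (Suc a)) + weight (d + a) 0))"
    by (intro mult_left_mono weight_step) simp
  also have "\<dots> = 4 * (15 ^ m * (\<Sum>j = 1..d. weight j (Suc a)) + 15 ^ m * weight (d + a) 0)"
    by (simp add: algebra_simps)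
  also have "\<dots> \<le> 4 * (139 * 4 ^ m * (\<Sum>s = 1..d. card (?X s)) + 139 * 4 ^ m * card (?X 0))"
    using up down by (intro mult_left_mono add_mono) auto
  also have "\<dots> = 139 * 4 ^ Suc m * (card (?X 0) + (\<Sum>s = 1..d. card (?X s)))"
    by (simp add: algebra_simps)
  also have "\<dots> \<le> 139 * 4 ^ Suc m * card (ends_ext P k (Suc m))"
    using sum_le by (intro mult_left_mono) auto
  finally show ?case .
qed

text \<open>Growth starts from the single point 0, that is, the empty array, in state
  \<open>(1, 0)\<close> of weight 1.\<close>

lemma card_ends_ge: "15 ^ n \<le> 139 * 4 ^ n * card {ends P n | P. generic P n}"
proof -
  let ?Z = "\<lambda>_. 0 :: real"
  have "state ?Z 0 1 0"
  proof -
    have "lev ?Z 0 = {0}" "low_mins ?Z 0 = {0}"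
      by (auto simp: lev_def low_mins_def thr_def)
    then show ?thesis by (simp add: state_def generic_def)
  qed
  then have "15 ^ n * weight 1 0 \<le> 139 * 4 ^ n * card (ends_ext ?Z 0 n)"
    by (rule card_ends_ext_ge)
  also have "\<dots> \<le> 139 * 4 ^ n * card {ends P n | P. generic P n}"
  proof (intro mult_left_mono card_mono)
    show "finite {ends P n | P. generic P n}"
      by (rule finite_subset[of _ "Pow ({..n} \<times> {..n})"]) (auto simp: ends_def)
  qed (auto simp: ends_ext_def)
  finally show ?thesis by (simp add: weight_def)
qed

section \<open>From patterns to bits\<close>

text \<open>The stored bits determine the pattern via \<open>dec\<close>, so there are at least as
  many bit strings as patterns. Strings of all lengths up to \<open>L\<close> are counted, which
  gives the exponent \<open>Suc L\<close>.\<close>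

lemma encoding_size:
  assumes enc: "encodes_RMaxSSQ n enc query"
    and len: "\<And>A. length A = n \<Longrightarrow> length (enc A) \<le> L"
  shows "15 ^ n \<le> 139 * 4 ^ n * (2 :: nat) ^ Suc L"
proof -
  define dec where
    "dec w = {(i, j). i < j \<and> j \<le> n \<and> (\<exists>a. query w (Suc i) j = Some (a, j))}" for w
  have "ends P n = dec (enc (arr P n))" if "generic P n" for P
  proof -
    have "query (enc (arr P n)) (Suc i) j = RMaxSSQ (arr P n) (Suc i) j" if "i < j" "j \<le> n" for i j
      using enc that by (auto simp: encodes_RMaxSSQ_def)
    moreover have "(\<exists>a. RMaxSSQ (arr P n) (Suc i) j = Some (a, j)) \<longleftrightarrow> thr P i (j - 1) < P j"
      if "i < j" "j \<le> n" for i j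
      using RMaxSSQ_arr_ends_iff that \<open>generic P n\<close> by (simp add: generic_def)
    ultimately show ?thesis
      unfolding dec_def ends_def by (simp cong: conj_cong)
  qed
  then have sub: "{ends P n | P. generic P n} \<subseteq> dec ` {w. length w \<le> L}"
    using len by fastforce
  have lists: "{w :: bool list. length w \<le> L} = {w. set w \<subseteq> UNIV \<and> length w \<le> L}"
    by simp
  have fin: "finite {w :: bool list. length w \<le> L}"
    unfolding lists by (rule finite_lists_length_le) simp
  have "card {ends P n | P. generic P n} \<le> card {w :: bool list. length w \<le> L}"
    using fin sub by (meson card_image_le card_mono finite_imageI le_trans)
  also have "\<dots> = (\<Sum>i\<le>L. 2 ^ i)"
    unfolding lists by (subst card_lists_length_le) auto
  also have "\<dots> \<le> 2 ^ Suc L"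
    by (induction L) auto
  finally have "139 * 4 ^ n * card {ends P n | P. generic P n} \<le> 139 * 4 ^ n * 2 ^ Suc L"
    by (intro mult_left_mono) auto
  with card_ends_ge show ?thesis
    by (rule le_trans)
qed

theorem theorem2:
  shows "\<exists>g :: nat \<Rightarrow> real. g \<in> \<Theta>(\<lambda>n. log 2 (real n)) \<and>
    (\<forall>\<^sub>F n in sequentially. \<forall>enc query. encodes_RMaxSSQ n enc query \<longrightarrow>
       (\<exists>A. length A = n \<and> real (length (enc A)) \<ge> 1.89113 * real n - g n))"
proof (intro exI[of _ "\<lambda>n. log 2 (real n)"] conjI)
  show "\<forall>\<^sub>F n in sequentially. \<forall>enc query. encodes_RMaxSSQ n enc query \<longrightarrow>
       (\<exists>A. length A = n \<and> real (length (enc A)) \<ge> 1.89113 * real n - log 2 (real n))"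
    \<comment> \<open>Here 278 is 139 * 2, the constant of \<open>encoding_size\<close> with one
      factor 2 taken from \<open>2 ^ Suc L\<close>. The logarithmic term contributes a factor
      \<open>1 / n\<close>, which absorbs it once \<open>n > 278\<close>.\<close>
    using eventually_gt_at_top[of "278 :: nat"]
  proof eventually_elim
    case (elim n)
    show ?case
    proof (intro allI impI)
      fix enc query assume enc: "encodes_RMaxSSQ n enc query"
      define r where "r = 1.89113 * real n - log 2 (real n)"
      have "\<exists>A. length A = n \<and> real (length (enc A)) \<ge> r"
      proof (rule ccontr)
        assume "\<not> ?thesis"
        then have less: "real (length (enc A)) < r" if "length A = n" for A
          using that by (auto simp: not_le)
        have r0: "0 < r"
          using less[of "replicate n 0"] by simp
        define L where "L = nat \<lfloor>r\<rfloor>"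
        have L: "real L \<le> r"
          using r0 by (simp add: L_def)
        have "length (enc A) \<le> L" if "length A = n" for A
          using less[OF that] r0 by (simp add: L_def le_nat_floor)
        then have size: "15 ^ n \<le> 139 * 4 ^ n * (2 :: nat) ^ Suc L"
          by (rule encoding_size[OF enc])
        have "(15 :: real) ^ n \<le> 139 * 4 ^ n * 2 ^ Suc L"
          using of_nat_mono[OF size, where 'a = real] by simp
        then have "(15 / 4 :: real) ^ n \<le> 278 * 2 powr real L"
          by (simp add: power_divide field_simps powr_realpow)
        also have "\<dots> \<le> 278 * 2 powr r"
          using L by simp
        also have "\<dots> = 278 / real n * 2 powr (1.89113 * real n)"
          using elim by (simp add: r_def powr_diff)
        also have "\<dots> < 1 * 2 powr (1.89113 * real n)"
          using elim by (intro mult_strict_right_mono) auto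
        also have "\<dots> \<le> 2 powr (1.9 * real n)"
          by simp
        also have "\<dots> = (2 powr 1.9) ^ n"
          by (simp add: powr_powr powr_realpow[symmetric])
        also have "\<dots> \<le> (15 / 4) ^ n"
        proof (intro power_mono)
          \<comment> \<open>The tenth power turns the exponent 1.9 into the integer 19, leaving a
            comparison of rationals.\<close>
          have "(2 powr 1.9) ^ 10 = (2 :: real) powr 19"
            by (simp add: powr_powr powr_realpow[symmetric] del: powr_numeral)
          also have "\<dots> \<le> (15 / 4) ^ 10"
            by (simp add: power_divide)
          finally show "2 powr 1.9 \<le> (15 / 4 :: real)"
            using power_le_imp_le_base[of "2 powr 1.9" 9 "15 / 4 :: real"] by simp
        qed simp
        finally show False by simp
      qed
      then show "\<exists>A. length A = n \<and> real (length (enc A)) \<ge> 1.89113 * real n - log 2 (real n)"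
        by (simp add: r_def)
    qed
  qed
qed simp

end
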